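(* Let $G=(V,E)$ be a finite undirected loopless graph (parallel edges allowed), and let $f:V\to\mathbb{Z}\cup\{-\infty\}$, $g:V\to\mathbb{Z}\cup\{+\infty\}$ with $f\le g$ be such that $G$ has an $(f,g)$-bounded orientation. An $(f,g)$-bounded orientation $D$ of $G$ is decreasingly minimal (among $(f,g)$-bounded orientations of $G$) if and only if there is no directed path in $D$ from a node $s$ to a node $t$ with $\varrho_D(t)\ge\varrho_D(s)+2$, $\varrho_D(s)<g(s)$ and $\varrho_D(t)>f(t)$.
   Context: $\varrho_D(v)$ is the in-degree of node $v$ in $D$. An orientation $D$ is $(f,g)$-bounded if $f(v)\le\varrho_D(v)\le g(v)$ for all $v\in V$. An orientation is decreasingly minimal among a family of orientations if its in-degree vector, sorted in decreasing order, is lexicographically smaller than or equal to that of every member of the family sorted likewise. *)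

theory Defs
  imports
    "Graph_Theory.Arc_Walk"
    "HOL-Library.Multiset"
    "HOL-Library.Extended"
begin

text \<open>
  An undirected multigraph is given by a vertex set \<open>V\<close>, a set \<open>E\<close> of edge names and a map
  \<open>ends\<close> sending each edge to its set of end nodes; parallel edges are distinct names with the
  same ends, and a loop would be an edge whose set of ends is a singleton.
\<close>

definition loopless_multigraph :: "'v set \<Rightarrow> 'e set \<Rightarrow> ('e \<Rightarrow> 'v set) \<Rightarrow> bool" where
  "loopless_multigraph V E ends \<longleftrightarrow>
     finite V \<and> finite E \<and> (\<forall>e\<in>E. ends e \<subseteq> V \<and> card (ends e) = 2)"

definition orientation_of ::
  "'v set \<Rightarrow> 'e set \<Rightarrow> ('e \<Rightarrow> 'v set) \<Rightarrow> ('v, 'e) pre_digraph \<Rightarrow> bool" where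
  "orientation_of V E ends D \<longleftrightarrow>
     verts D = V \<and> arcs D = E \<and> (\<forall>e\<in>E. {tail D e, head D e} = ends e)"

definition bounded_orientation ::
  "'v set \<Rightarrow> 'e set \<Rightarrow> ('e \<Rightarrow> 'v set) \<Rightarrow> ('v \<Rightarrow> int extended) \<Rightarrow> ('v \<Rightarrow> int extended) \<Rightarrow>
   ('v, 'e) pre_digraph \<Rightarrow> bool" where
  "bounded_orientation V E ends f g D \<longleftrightarrow>
     orientation_of V E ends D \<and>
     (\<forall>v\<in>V. f v \<le> Fin (int (in_degree D v)) \<and> Fin (int (in_degree D v)) \<le> g v)"

definition dec_in_degrees :: "('v, 'e) pre_digraph \<Rightarrow> nat list" where
  "dec_in_degrees D =
     rev (sorted_list_of_multiset (image_mset (in_degree D) (mset_set (verts D))))"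

definition decreasingly_minimal ::
  "(('v, 'e) pre_digraph \<Rightarrow> bool) \<Rightarrow> ('v, 'e) pre_digraph \<Rightarrow> bool" where
  "decreasingly_minimal P D \<longleftrightarrow>
     P D \<and> (\<forall>D'. P D' \<longrightarrow>
       dec_in_degrees D = dec_in_degrees D' \<or>
       (dec_in_degrees D, dec_in_degrees D') \<in> lexord less_than)"

end

theory Submission
  imports Defs "Graph_Theory.Digraph_Component"
begin

text \<open>
  Reversing a directed path from \<open>s\<close> to \<open>t\<close> moves one unit of in-degree from \<open>t\<close> to \<open>s\<close>, so a path
  as in the statement gives a decreasingly smaller orientation. Conversely, suppose that there is
  no such path in \<open>D\<close> and let \<open>H\<close> be another bounded orientation. If the in-degree vectors differ,
  then the arcs of \<open>D\<close> that \<open>H\<close> orients differently contain a path from a node \<open>s\<close> with smaller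
  in-degree in \<open>D\<close> than in \<open>H\<close> to a node \<open>t\<close> with larger in-degree in \<open>D\<close> than in \<open>H\<close>. Reversing
  this path in \<open>H\<close> keeps \<open>H\<close> bounded, brings it closer to \<open>D\<close>, and, because \<open>D\<close> has no improving
  path, does not increase the sorted in-degree vector of \<open>H\<close>.
\<close>

section \<open>Lexicographic comparison of decreasingly sorted multisets\<close>

lemma rev_sorted_list_of_multiset_union:
  fixes A B :: "'a::linorder multiset"
  assumes "\<And>a b. a \<in># A \<Longrightarrow> b \<in># B \<Longrightarrow> b \<le> a"
  shows "rev (sorted_list_of_multiset (A + B)) =
    rev (sorted_list_of_multiset A) @ rev (sorted_list_of_multiset B)"
proof -
  let ?l = "sorted_list_of_multiset B @ sorted_list_of_multiset A"
  have "sorted ?l"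
    using assms by (auto simp: sorted_append)
  then have "sorted_list_of_multiset (mset ?l) = ?l"
    by (simp only: sorted_list_of_multiset_mset sorted_sort_id)
  moreover have "mset ?l = A + B"
    by simp
  ultimately have "sorted_list_of_multiset (A + B) = ?l"
    by metis
  then show ?thesis
    by simp
qed

text \<open>Both lists begin with the entries of \<open>M\<close> that are at least
  \<open>a\<close>. After this common prefix the second list continues with \<open>a\<close>, while
  the first continues with a smaller entry, which exists because \<open>N\<close> is
  nonempty.\<close>

lemma lexord_rev_sorted_list_of_multiset_less:
  fixes M N K :: "nat multiset"
  assumes "N \<noteq> {#}" and "\<And>x. x \<in># N \<Longrightarrow> x < a" and "\<And>x. x \<in># K \<Longrightarrow> x < a"
  shows "(rev (sorted_list_of_multiset (M + N)),
    rev (sorted_list_of_multiset (M + add_mset a K))) \<in> lexord less_than"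
proof -
  let ?r = "\<lambda>M. rev (sorted_list_of_multiset M)"
  define A where "A = filter_mset (\<lambda>x. a \<le> x) M"
  define B where "B = filter_mset (\<lambda>x. \<not> a \<le> x) M"
  have M: "M = A + B"
    unfolding A_def B_def by (rule multiset_partition)
  have A: "a \<le> x" if "x \<in># A" for x
    using that by (simp add: A_def)
  have B: "x < a" if "x \<in># B" for x
    using that by (simp add: B_def)
  have l: "?r (M + N) = ?r A @ ?r (B + N)"
    unfolding M add.assoc
    by (rule rev_sorted_list_of_multiset_union) (use A B assms in fastforce)
  have "?r (M + add_mset a K) = ?r (A + ({#a#} + (B + K)))"
    by (simp add: M add.assoc)
  also have "\<dots> = ?r A @ ?r ({#a#} + (B + K))"
    by (rule rev_sorted_list_of_multiset_union) (use A B assms in fastforce)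
  also have "?r ({#a#} + (B + K)) = ?r {#a#} @ ?r (B + K)"
    by (rule rev_sorted_list_of_multiset_union) (use B assms in fastforce)
  finally have r: "?r (M + add_mset a K) = ?r A @ a # ?r (B + K)"
    by simp
  have set: "set (?r (B + N)) = set_mset (B + N)"
    by (simp only: set_rev set_sorted_list_of_multiset)
  then obtain y ys where y: "?r (B + N) = y # ys"
    using assms(1) by (cases "?r (B + N)") auto
  then have "y \<in># B + N"
    using set by (metis list.set_intros(1))
  then have "y < a"
    using B assms(2) by auto
  then show ?thesis
    unfolding l r y by (intro lexord_append_leftI) simp
qed

text \<open>The effect of moving one unit from a higher entry \<open>h\<close> to a lower entry
  \<open>l\<close>. The first alternative records a gap of exactly 1, so that a gap of at least 2
  forces a strict decrease.\<close>

lemma lexord_sorted_unit_transfer: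
  fixes x y :: "'v \<Rightarrow> nat"
  assumes V: "finite V" "h \<in> V" "l \<in> V" "h \<noteq> l"
    and eq: "\<And>v. v \<in> V \<Longrightarrow> v \<noteq> h \<Longrightarrow> v \<noteq> l \<Longrightarrow> y v = x v"
    and h: "y h + 1 = x h" and l: "y l = x l + 1"
    and le: "x l + 1 \<le> x h"
  shows "image_mset y (mset_set V) = image_mset x (mset_set V) \<and> x h = x l + 1 \<or>
    (rev (sorted_list_of_multiset (image_mset y (mset_set V))),
     rev (sorted_list_of_multiset (image_mset x (mset_set V)))) \<in> lexord less_than"
proof -
  define M where "M = image_mset x (mset_set (V - {h, l}))"
  have "V = insert h (insert l (V - {h, l}))"
    using V by auto
  then have V': "mset_set V = add_mset h (add_mset l (mset_set (V - {h, l})))"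
    using V by (metis Diff_iff finite_Diff insertCI insertE mset_set.insert finite_insert)
  have "image_mset y (mset_set (V - {h, l})) = M"
    unfolding M_def using V eq by (intro image_mset_cong) auto
  then have y: "image_mset y (mset_set V) = M + {#y h, y l#}"
    by (simp add: V')
  have x: "image_mset x (mset_set V) = M + add_mset (x h) {#x l#}"
    by (simp add: V' M_def)
  show ?thesis
  proof (cases "x h = x l + 1")
    \<comment> \<open>With gap 1 the move merely exchanges the two values.\<close>
    case True
    then have "y h = x l" "y l = x h"
      using h l by auto
    then show ?thesis
      using True unfolding x y by simp
  next
    \<comment> \<open>With gap at least 2 both new values lie strictly below the old maximum
      \<open>x h\<close>.\<close>
    case False
    then have "(rev (sorted_list_of_multiset (M + {#y h, y l#})),
        rev (sorted_list_of_multiset (M + add_mset (x h) {#x l#}))) \<in> lexord less_than"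
      using h l le by (intro lexord_rev_sorted_list_of_multiset_less) auto
    then show ?thesis
      unfolding x y by blast
  qed
qed

section \<open>Reversal of arcs and its effect on in-degrees\<close>

definition reverse_arcs :: "'e set \<Rightarrow> ('v, 'e) pre_digraph \<Rightarrow> ('v, 'e) pre_digraph" where
  "reverse_arcs X H = H\<lparr>tail := \<lambda>e. if e \<in> X then head H e else tail H e,
                        head := \<lambda>e. if e \<in> X then tail H e else head H e\<rparr>"

lemma reverse_arcs_simps [simp]:
  "verts (reverse_arcs X H) = verts H"
  "arcs (reverse_arcs X H) = arcs H"
  "tail (reverse_arcs X H) e = (if e \<in> X then head H e else tail H e)"
  "head (reverse_arcs X H) e = (if e \<in> X then tail H e else head H e)"
  by (simp_all add: reverse_arcs_def)

lemma orientation_of_reverse_arcs: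
  "orientation_of V E ends H \<Longrightarrow> orientation_of V E ends (reverse_arcs X H)"
  by (auto simp: orientation_of_def)

text \<open>Arcs outside \<open>X\<close> keep their heads and contribute the common part
  \<open>?C\<close> to both in-degrees. The additive form avoids truncated subtraction on
  naturals.\<close>

lemma in_degree_reverse_arcs:
  assumes "finite (arcs H)" and "X \<subseteq> arcs H"
  shows "in_degree (reverse_arcs X H) v + card {e \<in> X. head H e = v} =
    in_degree H v + card {e \<in> X. tail H e = v}"
proof -
  let ?C = "{e \<in> arcs H - X. head H e = v}"
  have fin: "finite X" "finite ?C"
    using assms finite_subset by auto
  have "in_arcs (reverse_arcs X H) v = ?C \<union> {e \<in> X. tail H e = v}"
    and "in_arcs H v = ?C \<union> {e \<in> X. head H e = v}"
    using assms by (auto simp: in_arcs_def)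
  then have "in_degree (reverse_arcs X H) v = card ?C + card {e \<in> X. tail H e = v}"
    and "in_degree H v = card ?C + card {e \<in> X. head H e = v}"
    unfolding in_degree_def using fin by (auto intro!: card_Un_disjoint)
  then show ?thesis
    by simp
qed

text \<open>A walk enters each node as often as it leaves it, except for its two ends, which the
  \<open>of_bool\<close> terms account for. Distinctness lets cardinalities of sets of arcs count
  the traversals.\<close>

lemma cas_balance:
  assumes "pre_digraph.cas D s p t" and "distinct p"
  shows "card {e \<in> set p. head D e = v} + of_bool (v = s) =
    card {e \<in> set p. tail D e = v} + of_bool (v = t)"
  using assms
proof (induction p arbitrary: s)
  case Nil
  then show ?case
    by (simp add: pre_digraph.cas.simps)
next
  case (Cons a p)
  have s: "s = tail D a" and p: "pre_digraph.cas D (head D a) p t"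
    using Cons.prems by (auto simp: pre_digraph.cas.simps)
  have card: "card {e \<in> set (a # p). g e = v} = of_bool (g a = v) + card {e \<in> set p. g e = v}"
    for g :: "_ \<Rightarrow> _"
  proof -
    have "{e \<in> set (a # p). g e = v} =
        (if g a = v then insert a {e \<in> set p. g e = v} else {e \<in> set p. g e = v})"
      by auto
    then show ?thesis
      using Cons.prems by simp
  qed
  show ?case
    using Cons.IH[OF p] Cons.prems(2) unfolding card s by (auto split: if_splits)
qed

text \<open>The path lives in \<open>D\<close>, but its arcs are reversed in \<open>H\<close>. The
  first part serves \<open>H\<close> equal to \<open>D\<close>. In the second, \<open>H\<close>
  orients the arcs of \<open>p\<close> oppositely, so they lead from \<open>t\<close> to
  \<open>s\<close> in \<open>H\<close> and the unit moves the other way.\<close>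

lemma in_degree_reverse_path:
  assumes "wf_digraph D" and "pre_digraph.apath D s p t"
    and "finite (arcs H)" and "set p \<subseteq> arcs H"
  shows "\<forall>e\<in>set p. head H e = head D e \<and> tail H e = tail D e \<Longrightarrow>
      in_degree (reverse_arcs (set p) H) v + of_bool (v = t) = in_degree H v + of_bool (v = s)"
    and "\<forall>e\<in>set p. head H e = tail D e \<and> tail H e = head D e \<Longrightarrow>
      in_degree (reverse_arcs (set p) H) v + of_bool (v = s) = in_degree H v + of_bool (v = t)"
proof -
  have "pre_digraph.cas D s p t"
    using assms(2) by (simp add: pre_digraph.apath_def pre_digraph.awalk_def)
  then have *: "card {e \<in> set p. head D e = v} + of_bool (v = s) =
      card {e \<in> set p. tail D e = v} + of_bool (v = t)"
    using wf_digraph.distinct_verts_imp_distinct[OF assms(1)] assms(2)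
    by (intro cas_balance) (auto simp: pre_digraph.apath_def)
  note rev = in_degree_reverse_arcs[OF assms(3,4), of v]
  show "in_degree (reverse_arcs (set p) H) v + of_bool (v = t) = in_degree H v + of_bool (v = s)"
    if "\<forall>e\<in>set p. head H e = head D e \<and> tail H e = tail D e"
  proof -
    have "{e \<in> set p. head H e = v} = {e \<in> set p. head D e = v}"
      "{e \<in> set p. tail H e = v} = {e \<in> set p. tail D e = v}"
      using that by auto
    then show ?thesis
      using * rev by simp
  qed
  show "in_degree (reverse_arcs (set p) H) v + of_bool (v = s) = in_degree H v + of_bool (v = t)"
    if "\<forall>e\<in>set p. head H e = tail D e \<and> tail H e = head D e"
  proof -
    have "{e \<in> set p. head H e = v} = {e \<in> set p. tail D e = v}"
      "{e \<in> set p. tail H e = v} = {e \<in> set p. head D e = v}"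
      using that by auto
    then show ?thesis
      using * rev by simp
  qed
qed

section \<open>Comparison of two orientations of the same graph\<close>

lemma sum_in_degree:
  assumes "finite R" and "finite (arcs D)"
  shows "(\<Sum>v\<in>R. in_degree D v) = card {e \<in> arcs D. head D e \<in> R}"
proof -
  have "{e \<in> arcs D. head D e \<in> R} = (\<Union>v\<in>R. in_arcs D v)"
    by (auto simp: in_arcs_def)
  then show ?thesis
    unfolding in_degree_def using assms
    by (subst card_UN_disjoint[symmetric]) (auto simp: in_arcs_def)
qed

lemma orientation_fin_digraph:
  assumes "loopless_multigraph V E ends" and "orientation_of V E ends D"
  shows "fin_digraph D"
  using assms by unfold_locales (auto simp: loopless_multigraph_def orientation_of_def)

lemma orientations_differ:
  assumes "loopless_multigraph V E ends"
    and "orientation_of V E ends D" and "orientation_of V E ends H"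
    and "e \<in> E" and "head D e \<noteq> head H e"
  shows "head H e = tail D e" and "tail H e = head D e"
proof -
  have "{tail D e, head D e} = {tail H e, head H e}"
    using assms by (auto simp: orientation_of_def)
  then show "head H e = tail D e" and "tail H e = head D e"
    using assms(5) by (auto simp: doubleton_eq_iff)
qed

text \<open>
  Let \<open>R\<close> be the set of nodes from which \<open>t\<close> can be reached along differing arcs. An edge whose head
  in \<open>D\<close> lies in \<open>R\<close> also has its head in \<open>H\<close> in \<open>R\<close>, so the total in-degree of \<open>R\<close> is not larger
  in \<open>D\<close> than in \<open>H\<close>, and \<open>t\<close> must be compensated by some \<open>s\<close> in \<open>R\<close>.
\<close>

lemma differing_path_exists:
  assumes G: "loopless_multigraph V E ends"
    and D: "orientation_of V E ends D" and H: "orientation_of V E ends H"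
    and t: "t \<in> V" "in_degree H t < in_degree D t"
  obtains s p where "s \<in> V" and "in_degree D s < in_degree H s"
    and "pre_digraph.apath D s p t" and "set p \<subseteq> {e \<in> E. head D e \<noteq> head H e}"
proof -
  interpret D: fin_digraph D
    using orientation_fin_digraph[OF G D] .
  interpret H: fin_digraph H
    using orientation_fin_digraph[OF G H] .
  define A where "A = {e \<in> E. head D e \<noteq> head H e}"
  have DV: "verts D = V" "arcs D = E" and HV: "verts H = V" "arcs H = E"
    using D H by (auto simp: orientation_of_def)
  \<comment> \<open>\<open>K\<close> keeps all nodes of \<open>D\<close> but only the arcs that
    \<open>H\<close> orients differently, so every walk in \<open>K\<close> consists of differing
    arcs.\<close>
  define K where "K = D\<lparr>arcs := A\<rparr>"
  have K [simp]: "verts K = V" "arcs K = A" "tail K = tail D" "head K = head D"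
    by (simp_all add: K_def DV)
  interpret K: wf_digraph K
    by unfold_locales (use D.tail_in_verts D.head_in_verts in \<open>auto simp: A_def DV\<close>)
  define R where "R = {v \<in> V. \<exists>p. K.awalk v p t}"
  have fin: "finite R" "finite E"
    using D.finite_verts D.finite_arcs by (auto simp: R_def DV)
  have "head H e \<in> R" if "e \<in> E" "head D e \<in> R" for e
  proof (cases "head D e = head H e")
    case True
    then show ?thesis using that by simp
  next
    \<comment> \<open>Here the head of \<open>e\<close> in \<open>H\<close> is its tail in
      \<open>D\<close>, and prepending \<open>e\<close> to a walk from its head in \<open>D\<close>
      to \<open>t\<close> puts that tail into \<open>R\<close>.\<close>
    case False
    then have e: "e \<in> A" and h: "head H e = tail D e"
      using that orientations_differ[OF G D H] by (auto simp: A_def)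
    obtain p where "K.awalk (head D e) p t"
      using \<open>head D e \<in> R\<close> by (auto simp: R_def)
    then have "K.awalk (tail D e) (e # p) t"
      using e by (simp add: K.awalk_Cons_iff)
    then show ?thesis
      using h that D.tail_in_verts unfolding R_def DV by auto
  qed
  then have "card {e \<in> E. head D e \<in> R} \<le> card {e \<in> E. head H e \<in> R}"
    using fin by (intro card_mono) auto
  then have le: "(\<Sum>v\<in>R. in_degree D v) \<le> (\<Sum>v\<in>R. in_degree H v)"
    using sum_in_degree[of R D] sum_in_degree[of R H] fin by (simp add: DV HV)
  have "K.awalk t [] t"
    using t by (simp add: K.awalk_Nil_iff)
  then have "t \<in> R"
    using t by (auto simp: R_def)
  have "\<exists>s\<in>R. in_degree D s < in_degree H s"
  proof (rule ccontr)
    assume "\<not> ?thesis"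
    then have "(\<Sum>v\<in>R. in_degree H v) < (\<Sum>v\<in>R. in_degree D v)"
      using fin t \<open>t \<in> R\<close> by (intro sum_strict_mono_ex1) (auto simp: not_less)
    then show False
      using le by simp
  qed
  then obtain s q where s: "s \<in> V" "in_degree D s < in_degree H s" and q: "K.awalk s q t"
    by (auto simp: R_def)
  define p where "p = K.awalk_to_apath q"
  have p: "K.apath s p t"
    unfolding p_def using q by (rule K.apath_awalk_to_apath)
  have "subgraph K D"
    by (intro subgraphI) (auto simp: A_def DV compatible_def K.wf_digraph D.wf_digraph)
  then have "D.apath s p t"
    using p by (rule D.subgraph_apath_imp_apath[rotated])
  moreover have "set p \<subseteq> A"
    using p by (auto simp: K.apath_def K.awalk_def)
  ultimately show thesis
    using that s unfolding A_def by blast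
qed

section \<open>The two directions of the characterisation\<close>

lemma dec_in_degrees_le_if_no_improving_path:
  assumes G: "loopless_multigraph V E ends"
    and D: "bounded_orientation V E ends f g D"
    and no_path: "\<And>s t p. pre_digraph.apath D s p t \<Longrightarrow>
      Fin (int (in_degree D s)) < g s \<Longrightarrow> f t < Fin (int (in_degree D t)) \<Longrightarrow>
      in_degree D t \<le> in_degree D s + 1"
    and H: "bounded_orientation V E ends f g H"
  shows "dec_in_degrees D = dec_in_degrees H \<or>
    (dec_in_degrees D, dec_in_degrees H) \<in> lexord less_than"
  using H
proof (induction "card {e \<in> E. head D e \<noteq> head H e}" arbitrary: H rule: less_induct)
  case less
  have D': "orientation_of V E ends D" and H': "orientation_of V E ends H"
    using D less.prems by (auto simp: bounded_orientation_def)
  interpret D: fin_digraph D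
    using orientation_fin_digraph[OF G D'] .
  interpret H: fin_digraph H
    using orientation_fin_digraph[OF G H'] .
  have DV: "verts D = V" "arcs D = E" and HV: "verts H = V" "arcs H = E"
    using D' H' by (auto simp: orientation_of_def)
  have fin: "finite V" "finite E"
    using G by (auto simp: loopless_multigraph_def)
  show ?case
  proof (cases "\<exists>t\<in>V. in_degree H t < in_degree D t")
    \<comment> \<open>No in-degree in \<open>H\<close> is below that in \<open>D\<close>, and both
      families sum to the number of edges, so they agree on \<open>V\<close>.\<close>
    case False
    have "in_degree D v = in_degree H v" if "v \<in> V" for v
    proof (rule ccontr)
      assume "in_degree D v \<noteq> in_degree H v"
      then have "in_degree D v < in_degree H v"
        using False that by (meson linorder_neqE_nat)
      then have "(\<Sum>v\<in>V. in_degree D v) < (\<Sum>v\<in>V. in_degree H v)"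
        using False fin that by (intro sum_strict_mono_ex1) (auto simp: not_less)
      moreover have "{e \<in> E. head D e \<in> V} = E" "{e \<in> E. head H e \<in> V} = E"
        using D.head_in_verts H.head_in_verts by (auto simp: DV HV)
      ultimately show False
        using sum_in_degree[of V D] sum_in_degree[of V H] fin by (simp add: DV HV)
    qed
    then have "image_mset (in_degree D) (mset_set V) = image_mset (in_degree H) (mset_set V)"
      using fin by (intro image_mset_cong) auto
    then show ?thesis
      by (simp add: dec_in_degrees_def DV HV)
  next
    case True
    then obtain t where t: "t \<in> V" "in_degree H t < in_degree D t"
      by blast
    obtain s p where s: "s \<in> V" "in_degree D s < in_degree H s"
      and path: "pre_digraph.apath D s p t"
      and p: "set p \<subseteq> {e \<in> E. head D e \<noteq> head H e}"
      using differing_path_exists[OF G D' H' t] by blast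
    have st: "s \<noteq> t"
      using s t by auto
    have bD: "f v \<le> Fin (int (in_degree D v))" "Fin (int (in_degree D v)) \<le> g v"
      and bH: "f v \<le> Fin (int (in_degree H v))" "Fin (int (in_degree H v)) \<le> g v"
      if "v \<in> V" for v
      using that D less.prems by (auto simp: bounded_orientation_def)
    \<comment> \<open>Feasibility of \<open>H\<close> leaves \<open>D\<close> slack at both ends of
      the path: below \<open>g s\<close> at \<open>s\<close> and above \<open>f t\<close> at
      \<open>t\<close>. Hence \<open>no_path\<close> applies.\<close>
    have "Fin (int (in_degree D s)) < Fin (int (in_degree H s))"
      using s by simp
    then have "Fin (int (in_degree D s)) < g s"
      using bH(2)[OF s(1)] by (rule less_le_trans)
    moreover have "Fin (int (in_degree H t)) < Fin (int (in_degree D t))"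
      using t by simp
    with bH(1)[OF t(1)] have "f t < Fin (int (in_degree D t))"
      by (rule le_less_trans)
    ultimately have Dts: "in_degree D t \<le> in_degree D s + 1"
      using no_path[OF path] by blast
    define H2 where "H2 = reverse_arcs (set p) H"
    have differ: "\<forall>e\<in>set p. head H e = tail D e \<and> tail H e = head D e"
      using p orientations_differ[OF G D' H'] by blast
    have deg: "in_degree H2 v + of_bool (v = s) = in_degree H v + of_bool (v = t)" for v
      unfolding H2_def
      by (rule in_degree_reverse_path(2)[OF D.wf_digraph path _ _ differ])
        (use p fin in \<open>auto simp: HV\<close>)
    have deg_s: "in_degree H2 s + 1 = in_degree H s"
      and deg_t: "in_degree H2 t = in_degree H t + 1"
      using deg[of s] deg[of t] st by auto
    have deg_v: "in_degree H2 v = in_degree H v" if "v \<noteq> s" "v \<noteq> t" for v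
      using deg[of v] that by simp
    \<comment> \<open>At \<open>s\<close> and at \<open>t\<close> the in-degrees of \<open>D\<close>
      and \<open>H\<close> differ by at least 1, so a unit step from \<open>H\<close> towards
      \<open>D\<close> stays between two feasible values.\<close>
    have b_s: "f s \<le> Fin (int (in_degree H2 s))" "Fin (int (in_degree H2 s)) \<le> g s"
      using order_trans[OF bD(1)[OF s(1)], of "Fin (int (in_degree H2 s))"]
        order_trans[OF _ bH(2)[OF s(1)], of "Fin (int (in_degree H2 s))"] deg_s s by auto
    have b_t: "f t \<le> Fin (int (in_degree H2 t))" "Fin (int (in_degree H2 t)) \<le> g t"
      using order_trans[OF bH(1)[OF t(1)], of "Fin (int (in_degree H2 t))"]
        order_trans[OF _ bD(2)[OF t(1)], of "Fin (int (in_degree H2 t))"] deg_t t by auto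
    have H2: "bounded_orientation V E ends f g H2"
      unfolding bounded_orientation_def
    proof (intro conjI ballI)
      show "orientation_of V E ends H2"
        unfolding H2_def using H' by (rule orientation_of_reverse_arcs)
      show "f v \<le> Fin (int (in_degree H2 v))" "Fin (int (in_degree H2 v)) \<le> g v"
        if "v \<in> V" for v
        using b_s b_t bH[OF that] deg_v[of v] by (cases "v = s"; cases "v = t"; simp)+
    qed
    define A where "A = {e \<in> E. head D e \<noteq> head H e}"
    \<comment> \<open>Reversal makes the arcs of \<open>p\<close> agree with \<open>D\<close> and
      changes no other arc. As \<open>s\<close> and \<open>t\<close> differ, \<open>p\<close> is
      nonempty, so the induction measure drops.\<close>
    have "{e \<in> E. head D e \<noteq> head H2 e} \<subseteq> A - set p"
      using differ by (auto simp: A_def H2_def split: if_splits)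
    moreover have "A - set p \<subset> A"
    proof -
      have "p \<noteq> []"
        using path st by (auto simp: D.apath_Nil_iff)
      then have "hd p \<in> set p"
        by simp
      moreover have "set p \<subseteq> A"
        using p by (simp add: A_def)
      ultimately show ?thesis
        by blast
    qed
    ultimately have "{e \<in> E. head D e \<noteq> head H2 e} \<subset> A"
      by (rule subset_psubset_trans)
    moreover have "finite A"
      using fin by (simp add: A_def)
    ultimately have "card {e \<in> E. head D e \<noteq> head H2 e} < card {e \<in> E. head D e \<noteq> head H e}"
      unfolding A_def by (rule psubset_card_mono[rotated])
    then have IH: "dec_in_degrees D = dec_in_degrees H2 \<or>
        (dec_in_degrees D, dec_in_degrees H2) \<in> lexord less_than"
      using less.hyps H2 by blast
    \<comment> \<open>Chain: \<open>in_degree H t + 1\<close> is at most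
      \<open>in_degree D t\<close>, hence at most \<open>in_degree D s + 1\<close>, hence at most
      \<open>in_degree H s\<close>. The unit therefore leaves the higher node.\<close>
    have "in_degree H t + 1 \<le> in_degree H s"
      using Dts s t by linarith
    then have "dec_in_degrees H2 = dec_in_degrees H \<or>
        (dec_in_degrees H2, dec_in_degrees H) \<in> lexord less_than"
      using lexord_sorted_unit_transfer[of V s t "in_degree H2" "in_degree H"]
        fin s t st deg_s deg_t deg_v
      by (auto simp: dec_in_degrees_def HV H2_def)
    then show ?thesis
      using IH lexord_trans[OF _ _ trans_less_than] by metis
  qed
qed

lemma improving_path_imp_lexord_smaller:
  assumes G: "loopless_multigraph V E ends"
    and D: "bounded_orientation V E ends f g D"
    and path: "pre_digraph.apath D s p t"
    and deg_le: "in_degree D s + 2 \<le> in_degree D t"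
    and gs: "Fin (int (in_degree D s)) < g s" and ft: "f t < Fin (int (in_degree D t))"
  shows "bounded_orientation V E ends f g (reverse_arcs (set p) D)"
    and "(dec_in_degrees (reverse_arcs (set p) D), dec_in_degrees D) \<in> lexord less_than"
proof -
  have D': "orientation_of V E ends D"
    using D by (auto simp: bounded_orientation_def)
  interpret D: fin_digraph D
    using orientation_fin_digraph[OF G D'] .
  have DV: "verts D = V" "arcs D = E"
    using D' by (auto simp: orientation_of_def)
  have fin: "finite V" "finite E"
    using G by (auto simp: loopless_multigraph_def)
  have walk: "D.awalk s p t"
    using path by (rule D.awalkI_apath)
  then have p: "set p \<subseteq> E" and sV: "s \<in> V" and tV: "t \<in> V"
    using D.awalk_hd_in_verts D.awalk_last_in_verts by (auto simp: D.awalk_def DV)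
  have st: "s \<noteq> t"
    using deg_le by auto
  let ?H = "reverse_arcs (set p) D"
  have deg: "in_degree ?H v + of_bool (v = t) = in_degree D v + of_bool (v = s)" for v
    by (rule in_degree_reverse_path(1)[OF D.wf_digraph path]) (use p fin in \<open>auto simp: DV\<close>)
  have deg_s: "in_degree ?H s = in_degree D s + 1"
    and deg_t: "in_degree ?H t + 1 = in_degree D t"
    using deg[of s] deg[of t] st by auto
  have deg_v: "in_degree ?H v = in_degree D v" if "v \<noteq> s" "v \<noteq> t" for v
    using deg[of v] that by simp
  have bD: "f v \<le> Fin (int (in_degree D v))" "Fin (int (in_degree D v)) \<le> g v"
    if "v \<in> V" for v
    using that D by (auto simp: bounded_orientation_def)
  \<comment> \<open>By integrality the strict inequality at \<open>s\<close> leaves room for one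
    more unit, also when \<open>g s\<close> is infinite; dually at \<open>t\<close>.\<close>
  have b_s: "f s \<le> Fin (int (in_degree ?H s))" "Fin (int (in_degree ?H s)) \<le> g s"
    using order_trans[OF bD(1)[OF sV], of "Fin (int (in_degree ?H s))"] gs deg_s
    by (auto, cases "g s", auto)
  have b_t: "f t \<le> Fin (int (in_degree ?H t))" "Fin (int (in_degree ?H t)) \<le> g t"
    using order_trans[OF _ bD(2)[OF tV], of "Fin (int (in_degree ?H t))"] ft deg_t
    by (cases "f t", auto)
  show "bounded_orientation V E ends f g ?H"
    unfolding bounded_orientation_def
  proof (intro conjI ballI)
    show "orientation_of V E ends ?H"
      using D' by (rule orientation_of_reverse_arcs)
    show "f v \<le> Fin (int (in_degree ?H v))" "Fin (int (in_degree ?H v)) \<le> g v"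
      if "v \<in> V" for v
      using b_s b_t bD[OF that] deg_v[of v] by (cases "v = s"; cases "v = t"; simp)+
  qed
  \<comment> \<open>The unit moves from \<open>t\<close> to \<open>s\<close>, and
    \<open>deg_le\<close> excludes the alternative with gap 1.\<close>
  show "(dec_in_degrees ?H, dec_in_degrees D) \<in> lexord less_than"
    using lexord_sorted_unit_transfer[of V t s "in_degree ?H" "in_degree D"]
      fin sV tV st deg_s deg_t deg_v deg_le
    by (auto simp: dec_in_degrees_def DV)
qed

theorem theorem9p1:
  fixes V :: "'v set" and E :: "'e set" and ends :: "'e \<Rightarrow> 'v set"
    and f g :: "'v \<Rightarrow> int extended"
    and D :: "('v, 'e) pre_digraph"
  assumes "loopless_multigraph V E ends"
    and "\<And>v. v \<in> V \<Longrightarrow> f v \<noteq> Pinf"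
    and "\<And>v. v \<in> V \<Longrightarrow> g v \<noteq> Minf"
    and "\<And>v. v \<in> V \<Longrightarrow> f v \<le> g v"
    and "\<exists>D\<^sub>0 :: ('v, 'e) pre_digraph. bounded_orientation V E ends f g D\<^sub>0"
    and "bounded_orientation V E ends f g D"
  shows "decreasingly_minimal (bounded_orientation V E ends f g) D \<longleftrightarrow>
    \<not> (\<exists>s t p. pre_digraph.apath D s p t
        \<and> in_degree D t \<ge> in_degree D s + 2
        \<and> Fin (int (in_degree D s)) < g s
        \<and> f t < Fin (int (in_degree D t)))"
    (is "?min \<longleftrightarrow> \<not> ?path")
proof
  assume ?min
  show "\<not> ?path"
  proof
    assume ?path
    then obtain H where "bounded_orientation V E ends f g H"
      and H: "(dec_in_degrees H, dec_in_degrees D) \<in> lexord less_than"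
      using improving_path_imp_lexord_smaller[OF assms(1,6)] by blast
    then have "dec_in_degrees D = dec_in_degrees H \<or>
        (dec_in_degrees D, dec_in_degrees H) \<in> lexord less_than"
      using \<open>?min\<close> by (simp add: decreasingly_minimal_def)
    then have "(dec_in_degrees D, dec_in_degrees D) \<in> lexord less_than"
      using H lexord_trans[OF _ _ trans_less_than] by metis
    then show False
      using lexord_irreflexive[of less_than] by simp
  qed
next
  assume no_path: "\<not> ?path"
  have "in_degree D t \<le> in_degree D s + 1"
    if "pre_digraph.apath D s p t" "Fin (int (in_degree D s)) < g s"
      "f t < Fin (int (in_degree D t))" for s t p
  proof (rule ccontr)
    assume "\<not> ?thesis"
    then have "in_degree D s + 2 \<le> in_degree D t"
      by simp
    then show False
      using no_path that by blast
  qed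
  then show ?min
    using dec_in_degrees_le_if_no_improving_path[OF assms(1,6)] assms(6)
    by (auto simp: decreasingly_minimal_def)
qed

end
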